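(* Let $H$ be a Heronian parallelogram with area $A$ and perimeter $P$. Then $H$ is amicable (that is, there exists a Heronian parallelogram $C$ whose perimeter equals $A$ and whose area equals $P$) if and only if $A$ is even and $(A/4)^2 \geq P$.
   Context: Parallelograms are (nondegenerate) parallelograms in the Euclidean plane. A convex polygon is Heronian if its side lengths are integers and its area is also an integer (the diagonals are not required to be integers). Two polygons are amicable if the area of one equals the perimeter of the other, and vice versa; the two polygons are not required to be non-congruent. A Heronian parallelogram $H$ is called amicable if it is part of an amicable pair of Heronian parallelograms, i.e. there is a Heronian parallelogram $C$ such that $H$ and $C$ are amicable. *)

theory Defs
  imports "HOL-Analysis.Analysis"
begin

(* A convex polygon is given by the list of its vertices in cyclic order. *)
type_synonym polygon = "(real^2) list"

definition side_length :: "polygon \<Rightarrow> nat \<Rightarrow> real" where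
  "side_length vs i = dist (vs ! i) (vs ! (Suc i mod length vs))"

definition perimeter :: "polygon \<Rightarrow> real" where
  "perimeter vs = (\<Sum>i<length vs. side_length vs i)"

(* The convex hull of the vertices is the polygonal region because only convex polygons
   are considered. *)
definition area :: "polygon \<Rightarrow> real" where
  "area vs = measure lebesgue (convex hull (set vs))"

definition heronian :: "polygon \<Rightarrow> bool" where
  "heronian vs \<longleftrightarrow> (\<forall>i<length vs. side_length vs i \<in> \<int>) \<and> area vs \<in> \<int>"

(* Opposite sides agree as vectors; non-collinearity of three vertices is nondegeneracy. *)
definition parallelogram :: "polygon \<Rightarrow> bool" where
  "parallelogram vs \<longleftrightarrow>
     (\<exists>a b c d. vs = [a, b, c, d] \<and> b - a = c - d \<and> \<not> collinear {a, b, c})"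

(* The two polygons may be congruent, or even equal. *)
definition amicable :: "polygon \<Rightarrow> polygon \<Rightarrow> bool" where
  "amicable H C \<longleftrightarrow> area H = perimeter C \<and> area C = perimeter H"

definition heronian_parallelogram :: "polygon \<Rightarrow> bool" where
  "heronian_parallelogram H \<longleftrightarrow> parallelogram H \<and> heronian H"

definition amicable_heronian_parallelogram :: "polygon \<Rightarrow> bool" where
  "amicable_heronian_parallelogram H \<longleftrightarrow>
     heronian_parallelogram H \<and> (\<exists>C. heronian_parallelogram C \<and> amicable H C)"

end

theory Submission
  imports Defs
begin

text \<open>
  Let a parallelogram have adjacent sides \<open>s\<close> and \<open>t\<close>. Its perimeter is \<open>2 (s + t)\<close>, and its
  area is the absolute value of the cross product of two adjacent edge vectors, hence at most
  \<open>s t\<close>. By the inequality of arithmetic and geometric means, \<open>s t \<le> ((s + t) / 2)\<^sup>2\<close>, which is the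
  square of a quarter of the perimeter. So a Heronian partner of \<open>H\<close>, having perimeter \<open>A\<close> and
  area \<open>P\<close>, forces both \<open>even A\<close> and \<open>P \<le> (A / 4)\<^sup>2\<close>.

  Conversely, with the side lengths fixed, tilting a rectangle realises every area in the
  interval from \<open>0\<close> (excluded) to \<open>s t\<close> (included), so it only remains to find positive integers
  with \<open>s + t = A / 2\<close> and \<open>s t \<ge> P\<close>. Splitting \<open>A / 2\<close> as evenly as possible works: if
  \<open>A / 2\<close> is odd, then \<open>s t\<close> falls short of \<open>(A / 4)\<^sup>2\<close> by just \<open>1 / 4\<close>, which is too little to
  fall below the integer \<open>P\<close>.
\<close>

definition cross2 :: "real^2 \<Rightarrow> real^2 \<Rightarrow> real" where
  "cross2 u v = u$1 * v$2 - u$2 * v$1"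

text \<open>Lagrange's identity: the defect \<open>(norm u * norm v)\<^sup>2 - (cross2 u v)\<^sup>2\<close> is the square of the
  inner product.\<close>

lemma abs_cross2_le: "\<bar>cross2 u v\<bar> \<le> norm u * norm v"
proof -
  have "(norm u * norm v)\<^sup>2 = (u \<bullet> u) * (v \<bullet> v)"
    by (simp add: power_mult_distrib power2_norm_eq_inner)
  also have "\<dots> = (cross2 u v)\<^sup>2 + (u \<bullet> v)\<^sup>2"
    by (simp add: cross2_def inner_vec_def sum_2 power2_eq_square algebra_simps)
  finally have "(cross2 u v)\<^sup>2 \<le> (norm u * norm v)\<^sup>2" by simp
  then show ?thesis
    by (simp add: abs_le_square_iff[symmetric] abs_mult)
qed

lemma convex_hull_unit_square:
  "convex hull {0, vector [1, 0], vector [1, 1], vector [0, 1]} = cbox (0 :: real^2) 1"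
proof -
  have "{x :: real^2. \<forall>i\<in>Basis. x \<bullet> i = 0 \<or> x \<bullet> i = 1}
      = {0, vector [1, 0], vector [1, 1], vector [0, 1]}"
    by (auto simp: Basis_vec_def inner_axis vec_eq_iff forall_2)
  moreover have "One = (1 :: real^2)"
    by (simp add: vec_eq_iff cart_eq_inner_axis[of One] axis_in_Basis_iff inner_sum_left_Basis
        del: sum_component inner_axis)
  ultimately show ?thesis
    using unit_interval_convex_hull[where 'a = "real^2"] by simp
qed

text \<open>The parallelogram is an affine image of the unit square, and the linear part of the map has
  the edge vectors as the columns of its matrix.\<close>

lemma area_parallelogram:
  assumes "b - a = c - d"
  shows "area [a, b, c, d] = \<bar>cross2 (b - a) (d - a)\<bar>"
proof -
  define f :: "real^2 \<Rightarrow> real^2" where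
    "f = (\<lambda>x. x$1 *\<^sub>R (b - a) + x$2 *\<^sub>R (d - a))"
  have lin: "linear f"
    unfolding f_def by (intro linearI) (simp_all add: algebra_simps)
  have c: "c = a + ((b - a) + (d - a))"
    using assms by (simp add: algebra_simps)
  have "{a, b, c, d} = (+) a ` f ` {0, vector [1, 0], vector [1, 1], vector [0, 1]}"
    unfolding c f_def by (simp add: insert_commute)
  then have hull: "convex hull {a, b, c, d} = (+) a ` f ` cbox 0 1"
    by (simp only: convex_hull_translation convex_hull_linear_image[OF lin, symmetric]
        convex_hull_unit_square)
  have det: "det (matrix f) = cross2 (b - a) (d - a)"
    by (simp add: det_2 matrix_def f_def cross2_def axis_def)
  have "area [a, b, c, d] = measure lebesgue (f ` cbox 0 1)"
    by (simp add: area_def hull measure_translation)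
  also have "\<dots> = \<bar>det (matrix f)\<bar> * measure lebesgue (cbox 0 (1 :: real^2))"
    by (rule measure_linear_image[OF lin]) simp
  also have "measure lebesgue (cbox 0 (1 :: real^2)) = 1"
    by (simp add: content_cbox_if_cart interval_eq_empty_cart)
  finally show ?thesis by (simp add: det)
qed

lemma opposite_sides:
  fixes a b c d :: "real^2"
  assumes "b - a = c - d"
  shows "dist c d = dist a b" "dist d a = dist b c"
proof -
  have "d - a = c - b"
    using assms by (simp add: algebra_simps)
  then show "dist d a = dist b c"
    by (metis dist_commute dist_norm)
  show "dist c d = dist a b"
    by (metis assms dist_commute dist_norm)
qed

lemma perimeter_parallelogram:
  assumes "b - a = c - d"
  shows "perimeter [a, b, c, d] = 2 * (dist a b + dist b c)"
  using opposite_sides[OF assms]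
  by (simp add: perimeter_def side_length_def lessThan_Suc)

lemma integral_sides_parallelogram:
  assumes "b - a = c - d"
  shows "(\<forall>i<length [a, b, c, d]. side_length [a, b, c, d] i \<in> \<int>)
    \<longleftrightarrow> dist a b \<in> \<int> \<and> dist b c \<in> \<int>"
  using opposite_sides[OF assms]
  by (auto simp: side_length_def less_Suc_eq)

lemma perimeter_parallelogram_pos:
  assumes "parallelogram H"
  shows "perimeter H > 0"
proof -
  obtain a b c d where H: "H = [a, b, c, d]" "b - a = c - d" "\<not> collinear {a, b, c}"
    using assms by (auto simp: parallelogram_def)
  then have "a \<noteq> b" by auto
  then have "dist a b + dist b c > 0"
    by (simp add: add_pos_nonneg)
  then show ?thesis
    using H by (simp add: perimeter_parallelogram)
qed

text \<open>The isoperimetric inequality for parallelograms, with equality for squares.\<close>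

lemma area_parallelogram_le:
  assumes "parallelogram C"
  shows "area C \<le> (perimeter C / 4)\<^sup>2"
proof -
  obtain a b c d where C: "C = [a, b, c, d]" "b - a = c - d"
    using assms by (auto simp: parallelogram_def)
  have "area C \<le> norm (b - a) * norm (d - a)"
    using C abs_cross2_le by (simp add: area_parallelogram)
  also have "\<dots> = dist a b * dist b c"
    using opposite_sides[OF C(2)] by (simp add: dist_norm norm_minus_commute)
  also have "\<dots> \<le> ((dist a b + dist b c) / 2)\<^sup>2"
    using zero_le_power2[of "dist a b - dist b c"]
    by (simp add: power2_eq_square field_simps)
  also have "\<dots> = (perimeter C / 4)\<^sup>2"
    using C by (simp add: perimeter_parallelogram)
  finally show ?thesis .
qed

lemma even_perimeter_heronian_parallelogram:
  fixes A :: int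
  assumes "heronian_parallelogram C" "perimeter C = of_int A"
  shows "even A"
proof -
  obtain a b c d where C: "C = [a, b, c, d]" "b - a = c - d"
    using assms by (auto simp: heronian_parallelogram_def parallelogram_def)
  have "dist a b \<in> \<int>" "dist b c \<in> \<int>"
    using assms(1) integral_sides_parallelogram[OF C(2)] C(1)
    by (simp_all add: heronian_parallelogram_def heronian_def)
  then obtain s t :: int where "dist a b = of_int s" "dist b c = of_int t"
    by (auto elim!: Ints_cases)
  then have "(of_int A :: real) = of_int (2 * (s + t))"
    using assms(2) C by (simp add: perimeter_parallelogram)
  then have "A = 2 * (s + t)"
    by (simp only: of_int_eq_iff)
  then show ?thesis by simp
qed

text \<open>Tilting a rectangle: on a base of length \<open>s\<close>, the height that gives area \<open>P\<close> is \<open>P / s\<close>, and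
  this is attained with the other side equal to \<open>t\<close> as soon as it does not exceed \<open>t\<close>.\<close>

lemma exists_parallelogram_sides_area:
  fixes s t P :: int
  assumes "s > 0" "t > 0" "P > 0" "P \<le> s * t"
  obtains C where "heronian_parallelogram C" "perimeter C = of_int (2 * (s + t))"
    "area C = of_int P"
proof -
  define h x :: real where "h = P / s" and "x = sqrt (t\<^sup>2 - h\<^sup>2)"
  define a b c d :: "real^2" where
    "a = 0" and "b = vector [s, 0]" and "c = vector [s + x, h]" and "d = vector [x, h]"
  have h: "h > 0" "s * h = P"
    using assms by (simp_all add: h_def)
  have "real_of_int P \<le> real_of_int s * real_of_int t"
    using assms(4) by (simp only: of_int_mult[symmetric] of_int_le_iff)
  then have "h \<le> t"
    using assms by (simp add: h_def field_simps)
  then have x: "x\<^sup>2 + h\<^sup>2 = t\<^sup>2"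
    using h by (simp add: x_def power_mono)
  have opp: "b - a = c - d"
    by (simp add: a_def b_def c_def d_def vec_eq_iff forall_2)
  have ab: "dist a b = s"
    using assms by (simp add: a_def b_def dist_norm norm_vec_def L2_set_def sum_2)
  have bc: "dist b c = t"
    using assms x by (simp add: b_def c_def dist_norm norm_vec_def L2_set_def sum_2)
  have "\<not> collinear {a, b, c}"
    using assms h by (auto simp: a_def b_def c_def collinear_lemma vec_eq_iff forall_2)
  then have par: "parallelogram [a, b, c, d]"
    using opp by (auto simp: parallelogram_def)
  have area: "area [a, b, c, d] = P"
    using assms h area_parallelogram[OF opp]
    by (simp add: cross2_def a_def b_def d_def)
  have "heronian_parallelogram [a, b, c, d]"
    unfolding heronian_parallelogram_def heronian_def integral_sides_parallelogram[OF opp]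
    using par area ab bc by simp
  moreover have "perimeter [a, b, c, d] = of_int (2 * (s + t))"
    using ab bc opp by (simp add: perimeter_parallelogram)
  ultimately show ?thesis
    using area by (rule that)
qed

text \<open>The witnesses are the two halves of \<open>n\<close>, rounded down and up: positive numbers with a fixed
  sum have the largest product when they are as close together as possible.\<close>

lemma exists_int_sum_product_ge:
  fixes n P :: int
  assumes "n > 0" "P > 0" "4 * P \<le> n\<^sup>2"
  obtains s t where "s > 0" "t > 0" "s + t = n" "P \<le> s * t"
proof (cases "even n")
  case True
  then obtain k where k: "n = 2 * k" by (elim evenE)
  show ?thesis
    using assms by (intro that[of k k]) (auto simp: k power2_eq_square)
next
  case False
  then obtain k where k: "n = 2 * k + 1" by (elim oddE)
  have "4 * P \<le> 4 * (k * (k + 1)) + 1"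
    using assms(3) by (simp add: k power2_eq_square algebra_simps)
  then have P: "P \<le> k * (k + 1)" by presburger
  (* n = 1 has no splitting into two positive parts, and must be excluded. *)
  have "k \<noteq> 0"
    using P assms(2) by auto
  then have "k > 0"
    using assms(1) k by simp
  then show ?thesis
    using P by (intro that[of k "k + 1"]) (auto simp: k)
qed

theorem theorem2:
  fixes H :: polygon and A P :: int
  assumes "heronian_parallelogram H"
    and "area H = of_int A"
    and "perimeter H = of_int P"
  shows "amicable_heronian_parallelogram H \<longleftrightarrow>
           even A \<and> (real_of_int A / 4)\<^sup>2 \<ge> real_of_int P"
proof
  assume "amicable_heronian_parallelogram H"
  then obtain C where C: "heronian_parallelogram C" "perimeter C = A" "area C = P"
    using assms by (auto simp: amicable_heronian_parallelogram_def amicable_def)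
  then show "even A \<and> (real_of_int A / 4)\<^sup>2 \<ge> real_of_int P"
    using even_perimeter_heronian_parallelogram area_parallelogram_le
    by (metis heronian_parallelogram_def)
next
  assume R: "even A \<and> (real_of_int A / 4)\<^sup>2 \<ge> real_of_int P"
  then obtain n where n: "A = 2 * n" by (elim conjE evenE)
  have P: "P > 0"
    using assms perimeter_parallelogram_pos[of H] by (simp add: heronian_parallelogram_def)
  have "4 * real_of_int P \<le> (real_of_int n)\<^sup>2"
    using R by (simp add: n power_divide)
  then have sq: "4 * P \<le> n\<^sup>2"
    by (metis of_int_le_iff of_int_mult of_int_numeral of_int_power)
  have "area H \<ge> 0"
    by (simp add: area_def)
  moreover have "n \<noteq> 0"
    using sq P by auto
  ultimately have "n > 0"
    using assms(2) n by simp
  then obtain s t where st: "s > 0" "t > 0" "s + t = n" "P \<le> s * t"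
    using exists_int_sum_product_ge P sq by metis
  then obtain C where "heronian_parallelogram C" "perimeter C = of_int (2 * (s + t))"
    "area C = of_int P"
    using exists_parallelogram_sides_area P by metis
  then show "amicable_heronian_parallelogram H"
    using assms n st(3)
    by (auto simp: amicable_heronian_parallelogram_def amicable_def)
qed

end
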